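(* Let $k > 0$ be a real number and let $X$ be a large real number. For every $Y$ with $0 < Y \le 1/2$ we have \[ \int_{-Y}^{Y} \vert S_k(\alpha) - U_k(\alpha) \vert^2 \, d\alpha \ll_k \frac{X^{2/k - 2} \log^2 X}{Y} + Y^2 X + Y^2 J_k\Bigl(X, \frac{1}{2Y}\Bigr). \]
   Context: Write $e(x) = e^{2\pi i x}$ and $\theta(x) = \sum_{p \le x} \log p$ (sum over primes). Define $S_k(\alpha) = \sum_{X \le p^k \le 2X} \log p \; e(p^k \alpha)$ (sum over primes $p$), $U_k(\alpha) = \sum_{X \le n^k \le 2X} e(n^k \alpha)$ (sum over positive integers $n$), and for $h > 0$ \[ J_k(X,h) = \int_X^{2X} \Bigl( \theta\bigl((x+h)^{1/k}\bigr) - \theta\bigl(x^{1/k}\bigr) - \bigl((x+h)^{1/k} - x^{1/k}\bigr) \Bigr)^2 dx . \] The implied constant depends only on $k$. *)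

theory Defs
  imports "HOL-Analysis.Analysis" "HOL-Computational_Algebra.Primes"
begin

definition e :: "real \<Rightarrow> complex" where
  "e x = exp (2 * of_real pi * \<i> * of_real x)"

definition chebyshev_theta :: "real \<Rightarrow> real" where
  "chebyshev_theta x = (\<Sum>p | prime p \<and> real p \<le> x. ln (real p))"

text \<open>
  The exponent \<open>k\<close> is an arbitrary real, hence the use of \<open>powr\<close>. For \<open>k > 0\<close> the index sets
  below are finite.
\<close>

definition S :: "real \<Rightarrow> real \<Rightarrow> real \<Rightarrow> complex" where
  "S k X \<alpha> = (\<Sum>p | prime p \<and> X \<le> real p powr k \<and> real p powr k \<le> 2 * X.
      of_real (ln (real p)) * e (real p powr k * \<alpha>))"

definition U :: "real \<Rightarrow> real \<Rightarrow> real \<Rightarrow> complex" where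
  "U k X \<alpha> = (\<Sum>n::nat | n > 0 \<and> X \<le> real n powr k \<and> real n powr k \<le> 2 * X.
      e (real n powr k * \<alpha>))"

definition J :: "real \<Rightarrow> real \<Rightarrow> real \<Rightarrow> real" where
  "J k X h = (LBINT x:{X..2 * X}.
      (chebyshev_theta ((x + h) powr (1 / k)) - chebyshev_theta (x powr (1 / k))
        - ((x + h) powr (1 / k) - x powr (1 / k)))\<^sup>2)"

end

theory Submission
  imports Defs "HOL-Probability.Sinc_Integral"
begin

text \<open>
  Write \<open>S - U\<close> as one exponential sum over the \<open>n\<close> with \<open>X \<le> n\<^sup>k \<le> 2X\<close>, with frequencies
  \<open>n\<^sup>k\<close> and coefficients \<open>1\<^bsub>prime\<^esub>(n) ln n - 1\<close>. Gallagher's lemma bounds its mean square over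
  \<open>[-Y, Y]\<close> by \<open>\<pi>\<^sup>2 Y\<^sup>2\<close> times the integral over \<open>x\<close> of the squared sum of the coefficients
  with frequency in \<open>(x, x + h]\<close>, where \<open>h = 1/(2Y)\<close>: the Fejer kernel
  \<open>(sin(\<pi>h\<alpha>)/(\<pi>\<alpha>))\<^sup>2\<close> is at least \<open>1/(\<pi>Y)\<^sup>2\<close> on \<open>[-Y, Y]\<close>, and its transform
  \<open>max(0, h - |t|)\<close> is the overlap of two windows of length \<open>h\<close> at distance \<open>t\<close>.
  A window inside \<open>[X, 2X]\<close> has the integrand of \<open>J\<close> as its sum up to a rounding error at most
  1. The remaining nonempty windows start in two intervals of length \<open>h\<close>; there the trivial bound
  \<open>O((1 + h X\<^bsup>1/k-1\<^esup>) ln X)\<close> is enough.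
\<close>

section \<open>The Fejer kernel and its Fourier transform\<close>

text \<open>Integration by parts gives the odd antiderivative \<open>G\<close>, so the symmetric
  integral is \<open>2 * G T\<close>. Writing \<open>Si\<close> at \<open>\<bar>c\<bar> * T\<close>
  makes its argument nonnegative, so that for nonzero c it tends to pi/2 whatever the sign of
  c.\<close>

lemma has_integral_one_minus_cos:
  fixes c T :: real
  assumes "T \<ge> 0"
  shows "((\<lambda>x. (1 - cos (c * x)) / x\<^sup>2) has_integral
           2 * (\<bar>c\<bar> * Si (\<bar>c\<bar> * T) - (1 - cos (c * T)) / T)) {-T..T}"
proof -
  define G where "G x = \<bar>c\<bar> * Si (\<bar>c\<bar> * x) - (1 - cos (c * x)) / x" for x
  \<comment> \<open>The quotient in \<open>G\<close> is 0 at x = 0 by the convention for division.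
    In terms of \<open>sinc\<close> it is visibly continuous there, so the fundamental theorem
    applies with 0 as the only exceptional point.\<close>
  have G_alt: "G = (\<lambda>x. \<bar>c\<bar> * Si (\<bar>c\<bar> * x) - c * sinc (c * x / 2) * sin (c * x / 2))"
  proof
    fix x
    have "1 - cos (c * x) = 2 * (sin (c * x / 2))\<^sup>2"
      using cos_double_sin[of "c * x / 2"] by simp
    moreover have "2 * (sin (c * x / 2))\<^sup>2 / x = c * sinc (c * x / 2) * sin (c * x / 2)"
      by (cases "x = 0"; cases "c = 0") (simp_all add: power2_eq_square)
    ultimately show "G x = \<bar>c\<bar> * Si (\<bar>c\<bar> * x) - c * sinc (c * x / 2) * sin (c * x / 2)"
      by (simp only: G_def)
  qed
  have cont: "continuous_on {-T..T} G"
  proof -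
    have "continuous_on UNIV Si"
      by (simp add: isCont_Si continuous_at_imp_continuous_on)
    then have "continuous_on {-T..T} (\<lambda>x. Si (\<bar>c\<bar> * x))"
      by (rule continuous_on_compose2) (auto intro!: continuous_intros)
    moreover have "continuous_on {-T..T} (\<lambda>x. sinc (c * x / 2))"
      by (rule continuous_on_compose2[OF continuous_on_sinc[OF continuous_on_id]])
         (auto intro!: continuous_intros)
    ultimately show ?thesis
      unfolding G_alt by (intro continuous_on_diff continuous_on_mult continuous_intros) auto
  qed
  have deriv: "(G has_vector_derivative (1 - cos (c * x)) / x\<^sup>2) (at x)" if "x \<noteq> 0" for x
  proof -
    have "((\<lambda>x. \<bar>c\<bar> * Si (\<bar>c\<bar> * x) - (1 - cos (c * x)) / x) has_real_derivative
        \<bar>c\<bar> * (sinc (\<bar>c\<bar> * x) * \<bar>c\<bar>) - ((sin (c * x) * c) * x - (1 - cos (c * x))) / x\<^sup>2) (at x)"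
      using that
      by (auto intro!: derivative_eq_intros DERIV_chain2[of Si] DERIV_Si simp: power2_eq_square)
    also have "\<bar>c\<bar> * (sinc (\<bar>c\<bar> * x) * \<bar>c\<bar>) = sin (c * x) * c / x"
    proof -
      have "sinc (\<bar>c\<bar> * x) = sinc (c * x)"
        by (cases "c \<ge> 0") (use sinc_neg[of "c * x"] in simp_all)
      moreover have "\<bar>c\<bar> * (sinc (c * x) * \<bar>c\<bar>) = sin (c * x) * c / x"
        using that by (cases "c = 0") (auto simp: abs_if field_simps)
      ultimately show ?thesis by simp
    qed
    also have "sin (c * x) * c / x - ((sin (c * x) * c) * x - (1 - cos (c * x))) / x\<^sup>2
        = (1 - cos (c * x)) / x\<^sup>2"
      using that by (simp add: field_simps power2_eq_square)
    finally show ?thesis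
      unfolding has_real_derivative_iff_has_vector_derivative G_def .
  qed
  have "((\<lambda>x. (1 - cos (c * x)) / x\<^sup>2) has_integral (G T - G (-T))) {-T..T}"
    using assms deriv cont
    by (intro fundamental_theorem_of_calculus_interior_strong[of "{0}"]) auto
  moreover have "G (-T) = - G T"
    using Si_neg[of "\<bar>c\<bar> * T"] assms by (simp add: G_def)
  ultimately have "((\<lambda>x. (1 - cos (c * x)) / x\<^sup>2) has_integral 2 * G T) {-T..T}"
    by simp
  then show ?thesis by (simp only: G_def)
qed

lemma tendsto_one_minus_cos_integral:
  fixes c :: real
  shows "((\<lambda>T. 2 * (\<bar>c\<bar> * Si (\<bar>c\<bar> * T) - (1 - cos (c * T)) / T)) \<longlongrightarrow> pi * \<bar>c\<bar>) at_top"
proof -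
  have "((\<lambda>T. (1 - cos (c * T)) / T) \<longlongrightarrow> 0) at_top"
  proof (rule Lim_null_comparison)
    show "\<forall>\<^sub>F T in at_top. norm ((1 - cos (c * T)) / T) \<le> 2 / T"
      using eventually_gt_at_top[of 0]
    proof eventually_elim
      case (elim T)
      have "\<bar>1 - cos (c * T)\<bar> \<le> 2"
        using cos_ge_minus_one[of "c * T"] cos_le_one[of "c * T"] by linarith
      then show ?case using elim by (simp add: divide_right_mono)
    qed
    show "((\<lambda>T. 2 / T) \<longlongrightarrow> (0::real)) at_top"
      by (intro tendsto_divide_0[OF tendsto_const] filterlim_at_top_imp_at_infinity filterlim_ident)
  qed
  moreover have "((\<lambda>T. \<bar>c\<bar> * Si (\<bar>c\<bar> * T)) \<longlongrightarrow> \<bar>c\<bar> * (pi / 2)) at_top"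
  proof (cases "c = 0")
    case False
    then have "filterlim (\<lambda>T. \<bar>c\<bar> * T) at_top at_top"
      by (intro filterlim_tendsto_pos_mult_at_top[OF tendsto_const _ filterlim_ident]) auto
    then show ?thesis
      by (intro tendsto_mult tendsto_const filterlim_compose[OF Si_at_top])
  qed simp
  ultimately have "((\<lambda>T. 2 * (\<bar>c\<bar> * Si (\<bar>c\<bar> * T) - (1 - cos (c * T)) / T)) \<longlongrightarrow>
      2 * (\<bar>c\<bar> * (pi / 2) - 0)) at_top"
    by (rule tendsto_mult[OF tendsto_const tendsto_diff, rotated])
  then show ?thesis by (simp add: mult.commute)
qed

text \<open>The product formula for cosines turns the integrand into a second difference of the
  functions (1 - cos(cx))/x^2. Their integrals tend to \<open>pi * \<bar>c\<bar>\<close>, so the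
  limit is half a second difference of the absolute value, which is the tent function. Truncated
  integrals with a limit suffice later, so no integral over the whole line appears.\<close>

lemma Fejer_transform:
  fixes h t :: real
  assumes "h > 0"
  obtains I where
    "\<And>T. T \<ge> 0 \<Longrightarrow> ((\<lambda>x. (sin (pi * h * x) / (pi * x))\<^sup>2 * cos (2 * pi * t * x)) has_integral I T) {-T..T}"
    "(I \<longlongrightarrow> max 0 (h - \<bar>t\<bar>)) at_top"
proof -
  define A where "A c T = 2 * (\<bar>c\<bar> * Si (\<bar>c\<bar> * T) - (1 - cos (c * T)) / T)" for c T :: real
  define I where "I T = (A (2 * pi * (h + t)) T + A (2 * pi * (h - t)) T - 2 * A (2 * pi * t) T) / (4 * pi\<^sup>2)" for T
  show ?thesis
  proof (rule that[of I])
    fix T :: real assume T: "T \<ge> 0"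
    have "((\<lambda>x. ((1 - cos (2 * pi * (h + t) * x)) / x\<^sup>2 + (1 - cos (2 * pi * (h - t) * x)) / x\<^sup>2
        - 2 * ((1 - cos (2 * pi * t * x)) / x\<^sup>2)) / (4 * pi\<^sup>2)) has_integral I T) {-T..T}"
      unfolding I_def A_def
      by (intro has_integral_divide has_integral_diff has_integral_add has_integral_mult_right
          has_integral_one_minus_cos T)
    moreover have "(sin (pi * h * x) / (pi * x))\<^sup>2 * cos (2 * pi * t * x) =
       ((1 - cos (2 * pi * (h + t) * x)) / x\<^sup>2 + (1 - cos (2 * pi * (h - t) * x)) / x\<^sup>2
        - 2 * ((1 - cos (2 * pi * t * x)) / x\<^sup>2)) / (4 * pi\<^sup>2)" for x
    proof -
      define a b where "a = 2 * pi * h * x" and "b = 2 * pi * t * x"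
      have ang: "2 * pi * (h + t) * x = a + b" "2 * pi * (h - t) * x = a - b"
        by (auto simp: a_def b_def algebra_simps)
      have "(sin (pi * h * x))\<^sup>2 = (1 - cos a) / 2"
        using cos_double_sin[of "pi * h * x"] by (simp add: a_def mult.assoc)
      then have "(sin (pi * h * x) / (pi * x))\<^sup>2 * cos (2 * pi * t * x) = (1 - cos a) / 2 / (pi * x)\<^sup>2 * cos b"
        by (simp only: power_divide b_def)
      also have "\<dots> = ((1 - cos (a + b)) / x\<^sup>2 + (1 - cos (a - b)) / x\<^sup>2 - 2 * ((1 - cos b) / x\<^sup>2)) / (4 * pi\<^sup>2)"
        by (cases "x = 0") (simp_all add: cos_add cos_diff field_simps power2_eq_square)
      finally show ?thesis
        by (simp only: ang b_def)
    qed
    ultimately show "((\<lambda>x. (sin (pi * h * x) / (pi * x))\<^sup>2 * cos (2 * pi * t * x)) has_integral I T) {-T..T}"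
      by simp
  next
    have "(I \<longlongrightarrow> (pi * \<bar>2 * pi * (h + t)\<bar> + pi * \<bar>2 * pi * (h - t)\<bar> - 2 * (pi * \<bar>2 * pi * t\<bar>)) / (4 * pi\<^sup>2)) at_top"
      unfolding I_def A_def by (intro tendsto_intros tendsto_one_minus_cos_integral) auto
    also have "(pi * \<bar>2 * pi * (h + t)\<bar> + pi * \<bar>2 * pi * (h - t)\<bar> - 2 * (pi * \<bar>2 * pi * t\<bar>)) / (4 * pi\<^sup>2)
        = (\<bar>h + t\<bar> + \<bar>h - t\<bar> - 2 * \<bar>t\<bar>) / 2"
    proof -
      have "\<bar>2 * pi * u\<bar> = 2 * pi * \<bar>u\<bar>" for u
        by (simp add: abs_mult)
      then show ?thesis by (simp only:) (simp add: field_simps power2_eq_square)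
    qed
    also have "\<dots> = max 0 (h - \<bar>t\<bar>)" using assms by (auto simp: max_def abs_if)
    finally show "(I \<longlongrightarrow> max 0 (h - \<bar>t\<bar>)) at_top" .
  qed
qed

section \<open>Gallagher's lemma\<close>

lemma e_eq_cis: "e x = cis (2 * pi * x)"
  by (simp add: e_def cis_conv_exp mult_ac)

lemma cmod_sum_e_squared:
  fixes c \<nu> :: "'a \<Rightarrow> real"
  shows "(cmod (\<Sum>n\<in>N. of_real (c n) * e (\<nu> n * \<alpha>)))\<^sup>2 =
         (\<Sum>m\<in>N. \<Sum>n\<in>N. c m * c n * cos (2 * pi * (\<nu> m - \<nu> n) * \<alpha>))"
proof -
  let ?z = "\<Sum>n\<in>N. of_real (c n) * e (\<nu> n * \<alpha>)"
  have "(cmod ?z)\<^sup>2 = Re (?z * cnj ?z)"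
    by (simp only: Re_complex_of_real flip: complex_norm_square)
  also have "?z * cnj ?z = (\<Sum>m\<in>N. \<Sum>n\<in>N. of_real (c m * c n) * cis (2 * pi * (\<nu> m - \<nu> n) * \<alpha>))"
    unfolding cnj_sum sum_product
    by (intro sum.cong refl) (simp add: e_eq_cis cis_cnj cis_mult algebra_simps)
  finally show ?thesis by simp
qed

text \<open>The frequency of n lies in the window at x iff x lies in
  \<open>{\<nu> n - h..<\<nu> n}\<close>. Two such intervals of length h meet in a set whose measure
  is the tent function at the difference of the frequencies. This is the same quadratic form that
  arises from the Fejer kernel.\<close>

lemma has_bochner_integral_window_sum_squared:
  fixes c \<nu> :: "'a \<Rightarrow> real"
  assumes "finite N" "h > 0"
  shows "has_bochner_integral lborel (\<lambda>x. (\<Sum>n | n \<in> N \<and> x < \<nu> n \<and> \<nu> n \<le> x + h. c n)\<^sup>2)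
           (\<Sum>m\<in>N. \<Sum>n\<in>N. c m * c n * max 0 (h - \<bar>\<nu> m - \<nu> n\<bar>))"
proof -
  have "(\<Sum>n | n \<in> N \<and> x < \<nu> n \<and> \<nu> n \<le> x + h. c n)\<^sup>2 =
      (\<Sum>m\<in>N. \<Sum>n\<in>N. c m * c n * indicator {max (\<nu> m) (\<nu> n) - h..<min (\<nu> m) (\<nu> n)} x)" for x
  proof -
    have "(\<Sum>n | n \<in> N \<and> x < \<nu> n \<and> \<nu> n \<le> x + h. c n) = (\<Sum>n\<in>N. c n * indicator {\<nu> n - h..<\<nu> n} x)"
      using assms(1) by (intro sum.mono_neutral_cong_left) (auto split: split_indicator)
    moreover have "indicator {\<nu> m - h..<\<nu> m} x * indicator {\<nu> n - h..<\<nu> n} x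
        = (indicator {max (\<nu> m) (\<nu> n) - h..<min (\<nu> m) (\<nu> n)} x :: real)" for m n
      by (auto split: split_indicator)
    ultimately show ?thesis
      by (simp add: power2_eq_square sum_product mult_ac)
  qed
  moreover have "has_bochner_integral lborel
      (\<lambda>x. c m * c n * indicator {max (\<nu> m) (\<nu> n) - h..<min (\<nu> m) (\<nu> n)} x)
      (c m * c n * max 0 (h - \<bar>\<nu> m - \<nu> n\<bar>))" for m n
  proof -
    have "measure lborel {max (\<nu> m) (\<nu> n) - h..<min (\<nu> m) (\<nu> n)} = max 0 (h - \<bar>\<nu> m - \<nu> n\<bar>)"
      by (cases "max (\<nu> m) (\<nu> n) - h \<le> min (\<nu> m) (\<nu> n)") auto
    moreover have "has_bochner_integral lborel
      (indicator {max (\<nu> m) (\<nu> n) - h..<min (\<nu> m) (\<nu> n)})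
      (measure lborel {max (\<nu> m) (\<nu> n) - h..<min (\<nu> m) (\<nu> n)})"
      using emeasure_bounded_finite[of "{max (\<nu> m) (\<nu> n) - h..<min (\<nu> m) (\<nu> n)}"]
      by (intro has_bochner_integral_real_indicator) auto
    ultimately show ?thesis by (intro has_bochner_integral_mult_right) auto
  qed
  ultimately show ?thesis by (simp add: has_bochner_integral_sum)
qed

text \<open>Plancherel's theorem is replaced by a comparison of double sums: the mean square
  weighted by the Fejer kernel and the energy of the window sums have the same coefficients, the
  former only in the limit of large T.\<close>

lemma Gallagher:
  fixes c \<nu> :: "'a \<Rightarrow> real"
  assumes fin: "finite N" and Y: "Y > 0"
  shows "(LBINT \<alpha>:{-Y..Y}. (cmod (\<Sum>n\<in>N. of_real (c n) * e (\<nu> n * \<alpha>)))\<^sup>2)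
     \<le> pi\<^sup>2 * Y\<^sup>2 * (LBINT x. (\<Sum>n | n \<in> N \<and> x < \<nu> n \<and> \<nu> n \<le> x + 1 / (2 * Y). c n)\<^sup>2)"
proof -
  define h where "h = 1 / (2 * Y)"
  have h: "h > 0" using Y by (simp add: h_def)
  define P where "P \<alpha> = (cmod (\<Sum>n\<in>N. of_real (c n) * e (\<nu> n * \<alpha>)))\<^sup>2" for \<alpha>
  define F where "F \<alpha> = (sin (pi * h * \<alpha>) / (pi * \<alpha>))\<^sup>2" for \<alpha>
  have P_eq: "P \<alpha> = (\<Sum>m\<in>N. \<Sum>n\<in>N. c m * c n * cos (2 * pi * (\<nu> m - \<nu> n) * \<alpha>))" for \<alpha>
    unfolding P_def by (rule cmod_sum_e_squared)
  have P0: "P \<alpha> \<ge> 0" for \<alpha> by (simp add: P_def)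
  obtain I where
    I: "\<And>t T. T \<ge> 0 \<Longrightarrow> ((\<lambda>x. F x * cos (2 * pi * t * x)) has_integral I t T) {-T..T}"
    and lim: "\<And>t. (I t \<longlongrightarrow> max 0 (h - \<bar>t\<bar>)) at_top"
  proof -
    have "\<forall>t. \<exists>I. (\<forall>T\<ge>0. ((\<lambda>x. F x * cos (2 * pi * t * x)) has_integral I T) {-T..T}) \<and>
        (I \<longlongrightarrow> max 0 (h - \<bar>t\<bar>)) at_top"
    proof
      fix t
      show "\<exists>I. (\<forall>T\<ge>0. ((\<lambda>x. F x * cos (2 * pi * t * x)) has_integral I T) {-T..T}) \<and>
        (I \<longlongrightarrow> max 0 (h - \<bar>t\<bar>)) at_top"
        unfolding F_def by (rule Fejer_transform[OF h, of t]) blast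
    qed
    from choice[OF this] that show thesis by blast
  qed
  have K: "((\<lambda>x. F x * P x) has_integral (\<Sum>m\<in>N. \<Sum>n\<in>N. c m * c n * I (\<nu> m - \<nu> n) T)) {-T..T}"
    if "T \<ge> 0" for T
  proof -
    have "((\<lambda>x. \<Sum>m\<in>N. \<Sum>n\<in>N. c m * c n * (F x * cos (2 * pi * (\<nu> m - \<nu> n) * x))) has_integral
      (\<Sum>m\<in>N. \<Sum>n\<in>N. c m * c n * I (\<nu> m - \<nu> n) T)) {-T..T}"
      using fin that by (intro has_integral_sum has_integral_mult_right I)
    then show ?thesis
      unfolding P_eq sum_distrib_left by (simp add: mult_ac)
  qed
  have Pint: "set_integrable lborel {-Y..Y} P"
    unfolding P_eq by (intro borel_integrable_atLeastAtMost' continuous_intros)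
  have dom: "P \<alpha> \<le> pi\<^sup>2 * Y\<^sup>2 * (F \<alpha> * P \<alpha>)" if "\<alpha> \<in> {-Y..Y}" "\<alpha> \<noteq> 0" for \<alpha>
  proof -
    have "1 \<le> pi * Y * (sin (pi * h * \<bar>\<alpha>\<bar>) / (pi * \<bar>\<alpha>\<bar>))"
    proof -
      \<comment> \<open>Since h = 1/(2Y), the angle is (pi/2)u with u at most 1. Concavity of the
        sine puts it above its chord from 0 to pi/2 (Jordan's inequality), and this yields the
        constant \<open>pi\<^sup>2 * Y\<^sup>2\<close>.\<close>
      define u where "u = \<bar>\<alpha>\<bar> / Y"
      have u: "0 < u" "u \<le> 1" using that Y by (auto simp: u_def)
      have "u \<le> sin (pi / 2 * u)"
      proof -
        have "convex_on {0..pi} (\<lambda>x. - sin x)"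
          by (rule f''_ge0_imp_convex[where f' = "\<lambda>x. - cos x" and f'' = sin])
             (auto intro!: derivative_eq_intros sin_ge_zero)
        from convex_onD[OF this, of u 0 "pi / 2"] u show ?thesis
          by (simp add: mult.commute)
      qed
      also have "pi / 2 * u = pi * h * \<bar>\<alpha>\<bar>" by (simp add: u_def h_def)
      finally show ?thesis using u that Y by (simp add: u_def field_simps)
    qed
    then have "1\<^sup>2 \<le> (pi * Y * (sin (pi * h * \<bar>\<alpha>\<bar>) / (pi * \<bar>\<alpha>\<bar>)))\<^sup>2"
      by (intro power_mono) auto
    also have "\<dots> = pi\<^sup>2 * Y\<^sup>2 * F \<alpha>"
      by (simp add: F_def power_mult_distrib power_divide abs_if)
    finally show ?thesis using mult_right_mono[OF _ P0[of \<alpha>]] by fastforce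
  qed
  \<comment> \<open>As \<open>F\<close> and \<open>P\<close> are nonnegative, enlarging the range of
    integration from Y to T only increases the weighted integral. The left side does not depend on
    T, so the limit can be taken afterwards.\<close>
  have bound: "integral {-Y..Y} P \<le> pi\<^sup>2 * Y\<^sup>2 * (\<Sum>m\<in>N. \<Sum>n\<in>N. c m * c n * I (\<nu> m - \<nu> n) T)" if "T \<ge> Y" for T
  proof -
    (* F 0 = 0 because x / 0 = 0, so dom fails at 0 and P is changed there. *)
    define Q where "Q \<alpha> = (if \<alpha> = 0 then 0 else P \<alpha>)" for \<alpha>
    have "(P has_integral integral {-Y..Y} P) {-Y..Y}"
      using set_borel_integral_eq_integral(1)[OF Pint] by (rule integrable_integral)
    then have Q: "(Q has_integral integral {-Y..Y} P) {-Y..Y}"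
      by (rule has_integral_spike_finite[of "{0}", rotated 2]) (auto simp: Q_def)
    have R: "((\<lambda>x. pi\<^sup>2 * Y\<^sup>2 * (F x * P x)) has_integral
       pi\<^sup>2 * Y\<^sup>2 * (\<Sum>m\<in>N. \<Sum>n\<in>N. c m * c n * I (\<nu> m - \<nu> n) T)) {-T..T}" if "T \<ge> 0" for T
      by (intro has_integral_mult_right K that)
    have "integral {-Y..Y} P = integral {-Y..Y} Q" using Q by (simp add: integral_unique)
    also have "\<dots> \<le> integral {-Y..Y} (\<lambda>x. pi\<^sup>2 * Y\<^sup>2 * (F x * P x))"
      using Q R[of Y] Y dom P0
      by (intro integral_le) (auto simp: Q_def F_def integrable_on_def)
    also have "\<dots> \<le> integral {-T..T} (\<lambda>x. pi\<^sup>2 * Y\<^sup>2 * (F x * P x))"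
    proof (rule integral_subset_le)
      show "(\<lambda>x. pi\<^sup>2 * Y\<^sup>2 * (F x * P x)) integrable_on {-Y..Y}"
        using R[of Y] Y by (auto simp: integrable_on_def)
      show "(\<lambda>x. pi\<^sup>2 * Y\<^sup>2 * (F x * P x)) integrable_on {-T..T}"
        using R[of T] Y that by (auto simp: integrable_on_def)
    qed (use that P0 in \<open>auto simp: F_def\<close>)
    also have "\<dots> = pi\<^sup>2 * Y\<^sup>2 * (\<Sum>m\<in>N. \<Sum>n\<in>N. c m * c n * I (\<nu> m - \<nu> n) T)"
      using R[of T] Y that by (intro integral_unique) auto
    finally show ?thesis .
  qed
  have "integral {-Y..Y} P \<le> pi\<^sup>2 * Y\<^sup>2 * (\<Sum>m\<in>N. \<Sum>n\<in>N. c m * c n * max 0 (h - \<bar>\<nu> m - \<nu> n\<bar>))"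
  proof (rule tendsto_lowerbound)
    show "((\<lambda>T. pi\<^sup>2 * Y\<^sup>2 * (\<Sum>m\<in>N. \<Sum>n\<in>N. c m * c n * I (\<nu> m - \<nu> n) T)) \<longlongrightarrow>
      pi\<^sup>2 * Y\<^sup>2 * (\<Sum>m\<in>N. \<Sum>n\<in>N. c m * c n * max 0 (h - \<bar>\<nu> m - \<nu> n\<bar>))) at_top"
      by (intro tendsto_mult tendsto_const tendsto_sum lim)
    show "\<forall>\<^sub>F T in at_top. integral {-Y..Y} P \<le> pi\<^sup>2 * Y\<^sup>2 * (\<Sum>m\<in>N. \<Sum>n\<in>N. c m * c n * I (\<nu> m - \<nu> n) T)"
      using eventually_ge_at_top[of Y] by eventually_elim (rule bound)
  qed simp
  also have "(\<Sum>m\<in>N. \<Sum>n\<in>N. c m * c n * max 0 (h - \<bar>\<nu> m - \<nu> n\<bar>)) =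
      (LBINT x. (\<Sum>n | n \<in> N \<and> x < \<nu> n \<and> \<nu> n \<le> x + h. c n)\<^sup>2)"
    using has_bochner_integral_window_sum_squared[OF fin h]
    by (rule has_bochner_integral_integral_eq[symmetric])
  finally show ?thesis
    unfolding set_borel_integral_eq_integral(2)[OF Pint, symmetric] by (simp only: h_def P_def[abs_def])
qed

section \<open>Counting k-th powers in short intervals\<close>

lemma powr_le_iff_le_root:
  fixes a k y :: real
  assumes "k > 0" "a \<ge> 0" "y \<ge> 0"
  shows "a powr k \<le> y \<longleftrightarrow> a \<le> y powr (1 / k)"
proof
  assume "a powr k \<le> y"
  then have "(a powr k) powr (1 / k) \<le> y powr (1 / k)"
    using assms by (intro powr_mono2) auto
  then show "a \<le> y powr (1 / k)" using assms by (simp add: powr_powr)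
next
  assume "a \<le> y powr (1 / k)"
  then have "a powr k \<le> (y powr (1 / k)) powr k"
    using assms by (intro powr_mono2) auto
  then show "a powr k \<le> y" using assms by (simp add: powr_powr)
qed

lemma finite_real_le: "finite {n::nat. P n \<and> real n \<le> y}"
  by (rule finite_subset[of _ "{..nat \<lfloor>y\<rfloor>}"]) (auto simp: le_nat_floor)

text \<open>Mean value theorem for the k-th root. The exponent 1/k - 1 can have either sign, so its
  power is largest near 2X or near X; the factor \<open>2 powr (1 / k)\<close> covers both
  cases.\<close>

lemma powr_root_diff_le:
  fixes k X u v :: real
  assumes "k > 0" "X > 0" "X \<le> u" "u \<le> v" "v \<le> 2 * X"
  shows "v powr (1 / k) - u powr (1 / k) \<le> 2 powr (1 / k) / k * X powr (1 / k - 1) * (v - u)"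
proof (cases "u = v")
  case False
  then have "u < v" using assms by simp
  have "\<exists>\<xi>>u. \<xi> < v \<and> v powr (1 / k) - u powr (1 / k) = (v - u) * (1 / k * \<xi> powr (1 / k - 1))"
    using assms by (intro MVT2 \<open>u < v\<close> has_real_derivative_powr) auto
  then obtain \<xi> where \<xi>: "u < \<xi>" "\<xi> < v"
    and eq: "v powr (1 / k) - u powr (1 / k) = (v - u) * (1 / k * \<xi> powr (1 / k - 1))"
    by blast
  have "\<xi> powr (1 / k - 1) \<le> 2 powr (1 / k) * X powr (1 / k - 1)"
  proof (cases "1 / k \<ge> 1")
    case True
    then have "\<xi> powr (1 / k - 1) \<le> (2 * X) powr (1 / k - 1)"
      using assms \<xi> by (intro powr_mono2) auto
    also have "\<dots> = 2 powr (1 / k - 1) * X powr (1 / k - 1)"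
      using assms by (simp add: powr_mult)
    also have "\<dots> \<le> 2 powr (1 / k) * X powr (1 / k - 1)"
      by (intro mult_right_mono powr_mono) auto
    finally show ?thesis .
  next
    case False
    then have "\<xi> powr (1 / k - 1) \<le> X powr (1 / k - 1)"
      using assms \<xi> by (intro powr_mono2') auto
    also have "\<dots> \<le> 2 powr (1 / k) * X powr (1 / k - 1)"
      using assms ge_one_powr_ge_zero[of 2 "1 / k"] by (simp add: mult_le_cancel_right1)
    finally show ?thesis .
  qed
  then have "(v - u) * (1 / k * \<xi> powr (1 / k - 1)) \<le> (v - u) * (1 / k * (2 powr (1 / k) * X powr (1 / k - 1)))"
    using assms by (intro mult_left_mono) auto
  then show ?thesis unfolding eq by (simp add: mult_ac)
qed simp

text \<open>The set lies between its least and greatest elements, which are k-th roots of two points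
  of \<open>[X, 2X]\<close> at distance at most h. The summand 1 counts the endpoint.\<close>

lemma card_window_le:
  fixes k X h x :: real and W :: "nat set"
  assumes "k > 0" "X > 0" "h \<ge> 0" "finite W"
    and W: "\<And>n. n \<in> W \<Longrightarrow> X \<le> real n powr k \<and> real n powr k \<le> 2 * X \<and> x < real n powr k \<and> real n powr k \<le> x + h"
  shows "real (card W) \<le> 1 + 2 powr (1 / k) / k * X powr (1 / k - 1) * h"
proof (cases "W = {}")
  case False
  define m n where "m = Min W" and "n = Max W"
  have mn: "m \<in> W" "n \<in> W" "m \<le> n"
    using False assms by (auto simp: m_def n_def)
  have "card W \<le> card {m..n}"
    using assms by (intro card_mono) (auto simp: m_def n_def)
  then have "real (card W) \<le> 1 + (real n - real m)" using mn by simp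
  also have "real n - real m = (real n powr k) powr (1 / k) - (real m powr k) powr (1 / k)"
    using assms by (simp add: powr_powr)
  also have "\<dots> \<le> 2 powr (1 / k) / k * X powr (1 / k - 1) * (real n powr k - real m powr k)"
    using assms(1,2) W[OF mn(1)] W[OF mn(2)] mn(3) by (intro powr_root_diff_le powr_mono2) auto
  also have "\<dots> \<le> 2 powr (1 / k) / k * X powr (1 / k - 1) * h"
    using assms(1) W[OF mn(1)] W[OF mn(2)] by (intro mult_left_mono) auto
  finally show ?thesis by simp
qed (use assms in auto)

section \<open>The error of theta in short intervals\<close>

lemma chebyshev_theta_mono: "x \<le> y \<Longrightarrow> chebyshev_theta x \<le> chebyshev_theta y"
  unfolding chebyshev_theta_def
  by (rule sum_mono2[OF finite_real_le]) (auto simp: prime_gt_0_nat Suc_le_eq)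

lemma chebyshev_theta_nonneg: "chebyshev_theta x \<ge> 0"
  unfolding chebyshev_theta_def by (rule sum_nonneg) (auto simp: prime_gt_0_nat Suc_le_eq)

lemma chebyshev_theta_diff:
  fixes k x h :: real
  assumes "k > 0" "x \<ge> 0" "h \<ge> 0"
  shows "chebyshev_theta ((x + h) powr (1 / k)) - chebyshev_theta (x powr (1 / k)) =
         (\<Sum>p | prime p \<and> x < real p powr k \<and> real p powr k \<le> x + h. ln (real p))"
proof -
  have "x powr (1 / k) \<le> (x + h) powr (1 / k)" using assms by (intro powr_mono2) auto
  then have sub: "{p::nat. prime p \<and> real p \<le> x powr (1 / k)} \<subseteq> {p. prime p \<and> real p \<le> (x + h) powr (1 / k)}"
    by auto
  have eq: "{p. prime p \<and> x < real p powr k \<and> real p powr k \<le> x + h} =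
      {p. prime p \<and> real p \<le> (x + h) powr (1 / k)} - {p. prime p \<and> real p \<le> x powr (1 / k)}"
    using assms by (auto simp flip: powr_le_iff_le_root)
  show ?thesis
    unfolding eq chebyshev_theta_def by (rule sum_diff[OF finite_real_le sub, symmetric])
qed

text \<open>The count is the difference of the floors of the two roots, and two fractional parts
  differ by less than 1. The index 0 does not enter, because \<open>0 powr k = 0\<close> is below
  x.\<close>

lemma card_window_approx:
  fixes k x h :: real
  assumes "k > 0" "x > 0" "h \<ge> 0"
  shows "\<bar>real (card {n. x < real n powr k \<and> real n powr k \<le> x + h})
          - ((x + h) powr (1 / k) - x powr (1 / k))\<bar> \<le> 1"
proof -
  define a b where "a = x powr (1 / k)" and "b = (x + h) powr (1 / k)"
  have ab: "0 \<le> a" "a \<le> b" using assms by (auto simp: a_def b_def intro!: powr_mono2)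
  have "{n. x < real n powr k \<and> real n powr k \<le> x + h} = {nat \<lfloor>a\<rfloor><..nat \<lfloor>b\<rfloor>}"
  proof -
    have "x < real n powr k \<longleftrightarrow> nat \<lfloor>a\<rfloor> < n" "real n powr k \<le> x + h \<longleftrightarrow> n \<le> nat \<lfloor>b\<rfloor>" for n
      using powr_le_iff_le_root[of k "real n" x] powr_le_iff_le_root[of k "real n" "x + h"] assms ab
        le_nat_floor[of n a] le_nat_floor[of n b]
      unfolding a_def[symmetric] b_def[symmetric] by linarith+
    then show ?thesis by auto
  qed
  moreover have "nat \<lfloor>a\<rfloor> \<le> nat \<lfloor>b\<rfloor>" using ab by (intro nat_mono floor_mono)
  ultimately have "real (card {n. x < real n powr k \<and> real n powr k \<le> x + h}) = of_int \<lfloor>b\<rfloor> - of_int \<lfloor>a\<rfloor>"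
    using ab by (simp add: of_nat_diff)
  then show ?thesis unfolding a_def[symmetric] b_def[symmetric] by linarith
qed

definition theta_error :: "real \<Rightarrow> real \<Rightarrow> real \<Rightarrow> real" where
  "theta_error k h x = chebyshev_theta ((x + h) powr (1 / k)) - chebyshev_theta (x powr (1 / k))
     - ((x + h) powr (1 / k) - x powr (1 / k))"

text \<open>The integral in \<open>J\<close> would take the default value 0 if its integrand were
  not integrable, so a bound by \<open>J\<close> needs this. Measurability comes from the
  monotonicity of theta, and boundedness from its value at the largest argument.\<close>

lemma set_integrable_theta_error:
  assumes "k > 0" "X > 0" "h > 0"
  shows "set_integrable lborel {X..2 * X} (\<lambda>x. (theta_error k h x)\<^sup>2)"
  unfolding set_integrable_def
proof (rule integrableI_bounded_set_indicator)
  have [measurable]: "chebyshev_theta \<in> borel_measurable borel"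
    by (rule borel_measurable_mono) (simp add: mono_def chebyshev_theta_mono)
  show "(\<lambda>x. (theta_error k h x)\<^sup>2) \<in> borel_measurable lborel"
    unfolding theta_error_def by measurable
  define b where "b = (2 * X + h) powr (1 / k)"
  show "AE x in lborel. x \<in> {X..2 * X} \<longrightarrow> norm ((theta_error k h x)\<^sup>2) \<le> (chebyshev_theta b + b)\<^sup>2"
  proof (intro AE_I2 impI)
    fix x assume x: "x \<in> {X..2 * X}"
    have 1: "x powr (1 / k) \<le> (x + h) powr (1 / k)" "(x + h) powr (1 / k) \<le> b"
      using x assms by (auto simp: b_def intro!: powr_mono2)
    have "\<bar>theta_error k h x\<bar> \<le> chebyshev_theta b + b"
      using 1 chebyshev_theta_mono[OF 1(1)] chebyshev_theta_mono[OF 1(2)]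
        chebyshev_theta_nonneg[of "x powr (1 / k)"] powr_ge_zero[of x "1 / k"]
      unfolding theta_error_def by linarith
    then show "norm ((theta_error k h x)\<^sup>2) \<le> (chebyshev_theta b + b)\<^sup>2"
      using power_mono[of "\<bar>theta_error k h x\<bar>" _ 2] by simp
  qed
qed (use assms in auto)

lemma J_nonneg: "J k X h \<ge> 0"
  unfolding J_def set_lebesgue_integral_def by (rule Bochner_Integration.integral_nonneg) auto

section \<open>The coefficients of S - U and their window sums\<close>

text \<open>The elements are the bases n; the powers themselves serve as the frequencies.\<close>

definition powers_range :: "real \<Rightarrow> real \<Rightarrow> nat set" where
  "powers_range k X = {n. n > 0 \<and> X \<le> real n powr k \<and> real n powr k \<le> 2 * X}"

definition coeff_SU :: "nat \<Rightarrow> real" where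
  "coeff_SU n = (if prime n then ln (real n) else 0) - 1"

lemma finite_powers_range: "k > 0 \<Longrightarrow> X \<ge> 0 \<Longrightarrow> finite (powers_range k X)"
  by (rule finite_subset[OF _ finite_real_le[of "\<lambda>_. True" "(2 * X) powr (1 / k)"]])
     (auto simp: powers_range_def simp flip: powr_le_iff_le_root)

lemma S_minus_U:
  assumes "k > 0" "X \<ge> 0"
  shows "S k X \<alpha> - U k X \<alpha> = (\<Sum>n\<in>powers_range k X. of_real (coeff_SU n) * e (real n powr k * \<alpha>))"
proof -
  have "S k X \<alpha> = (\<Sum>n\<in>powers_range k X. of_real (if prime n then ln (real n) else 0) * e (real n powr k * \<alpha>))"
    unfolding S_def using finite_powers_range[OF assms]
    by (intro sum.mono_neutral_cong_left) (auto simp: powers_range_def prime_gt_0_nat)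
  then show ?thesis
    by (simp add: U_def powers_range_def coeff_SU_def left_diff_distrib sum_subtractf)
qed

text \<open>The threshold 3 exceeds e, so \<open>ln X\<close> is at least 1 and absorbs the constant
  term. It also gives 2X <= X^2, whence k ln n <= 2 ln X.\<close>

lemma abs_coeff_SU_le:
  assumes "k > 0" "X \<ge> 3" "n \<in> powers_range k X"
  shows "\<bar>coeff_SU n\<bar> \<le> (2 / k + 1) * ln X"
proof -
  have "exp 1 \<le> X" using assms exp_le by linarith
  then have l1: "1 \<le> ln X" using assms by (simp add: ln_ge_iff)
  have n: "n > 0" "real n powr k \<le> 2 * X" using assms by (auto simp: powers_range_def)
  have "k * ln (real n) = ln (real n powr k)" using n by (simp add: ln_powr)
  also have "\<dots> \<le> ln (X * X)" using n assms by (intro ln_mono) (auto intro: order.trans)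
  also have "\<dots> = 2 * ln X" using assms by (simp add: ln_mult)
  finally have "ln (real n) \<le> 2 / k * ln X" using assms by (simp add: field_simps)
  moreover have "ln (real n) \<ge> 0" using n by simp
  ultimately have "\<bar>coeff_SU n\<bar> \<le> 2 / k * ln X + 1" unfolding coeff_SU_def by auto
  then show ?thesis using l1 by (simp add: algebra_simps)
qed

definition window_sum :: "real \<Rightarrow> real \<Rightarrow> real \<Rightarrow> real \<Rightarrow> real" where
  "window_sum k X h x = (\<Sum>n | n \<in> powers_range k X \<and> x < real n powr k \<and> real n powr k \<le> x + h. coeff_SU n)"

lemma window_sum_interior:
  assumes "k > 0" "X > 0" "h > 0" "X \<le> x" "x + h \<le> 2 * X"
  shows "\<bar>window_sum k X h x - theta_error k h x\<bar> \<le> 1"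
proof -
  let ?W = "{n. x < real n powr k \<and> real n powr k \<le> x + h}"
  \<comment> \<open>The window lies inside \<open>[X, 2X]\<close>, so both range conditions are
    automatic.\<close>
  have W: "{n. n \<in> powers_range k X \<and> x < real n powr k \<and> real n powr k \<le> x + h} = ?W"
  proof -
    have "n > 0" if "x < real n powr k" for n :: nat
      using that assms by (cases n) auto
    then show ?thesis using assms by (auto simp: powers_range_def)
  qed
  have fin: "finite ?W"
    unfolding W[symmetric] using finite_powers_range[of k X] assms by simp
  have "window_sum k X h x = (\<Sum>n\<in>?W. if prime n then ln (real n) else 0) - real (card ?W)"
    unfolding window_sum_def W coeff_SU_def by (simp add: sum_subtractf)
  also have "(\<Sum>n\<in>?W. if prime n then ln (real n) else 0) =
      (\<Sum>p | prime p \<and> x < real p powr k \<and> real p powr k \<le> x + h. ln (real p))"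
    using fin by (intro sum.mono_neutral_cong_right) auto
  also have "\<dots> = chebyshev_theta ((x + h) powr (1 / k)) - chebyshev_theta (x powr (1 / k))"
    using assms by (intro chebyshev_theta_diff[symmetric]) auto
  finally show ?thesis
    using card_window_approx[of k x h] assms unfolding theta_error_def by linarith
qed

lemma abs_window_sum_le:
  assumes "k > 0" "X \<ge> 3" "h > 0"
  shows "\<bar>window_sum k X h x\<bar> \<le>
     (1 + 2 powr (1 / k) / k * X powr (1 / k - 1) * h) * ((2 / k + 1) * ln X)"
proof -
  let ?W = "{n. n \<in> powers_range k X \<and> x < real n powr k \<and> real n powr k \<le> x + h}"
  have "\<bar>window_sum k X h x\<bar> \<le> (\<Sum>n\<in>?W. \<bar>coeff_SU n\<bar>)"
    unfolding window_sum_def by (rule sum_abs)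
  also have "\<dots> \<le> real (card ?W) * ((2 / k + 1) * ln X)"
    using assms by (intro sum_bounded_above abs_coeff_SU_le) auto
  also have "\<dots> \<le> (1 + 2 powr (1 / k) / k * X powr (1 / k - 1) * h) * ((2 / k + 1) * ln X)"
  proof (intro mult_right_mono card_window_le)
    show "finite ?W" using assms finite_powers_range[of k X] by simp
  qed (use assms in \<open>auto simp: powers_range_def\<close>)
  finally show ?thesis .
qed

text \<open>Interior windows cost twice \<open>J\<close> plus twice the squared rounding error over
  a range of length X. Each of the two edge intervals has length h and costs
  \<open>M\<^sup>2 * h\<close>.\<close>

lemma window_sum_energy:
  assumes "k > 0" "X \<ge> 3" "h > 0"
  defines "M \<equiv> (1 + 2 powr (1 / k) / k * X powr (1 / k - 1) * h) * ((2 / k + 1) * ln X)"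
  shows "(LBINT x. (window_sum k X h x)\<^sup>2) \<le> 2 * J k X h + 2 * X + 2 * M\<^sup>2 * h"
proof -
  let ?R = "\<lambda>x. 2 * (indicator {X..2 * X} x *\<^sub>R (theta_error k h x)\<^sup>2) + 2 * indicator {X..2 * X} x
      + (M\<^sup>2 * indicator {X - h..X} x + M\<^sup>2 * indicator {2 * X - h..2 * X} x)"
  have ind: "has_bochner_integral lborel (indicator {a..b}) (b - a)" if "a \<le> b" for a b :: real
    using has_bochner_integral_real_indicator[of "{a..b}" lborel] that by simp
  have "has_bochner_integral lborel (\<lambda>x. indicator {X..2 * X} x *\<^sub>R (theta_error k h x)\<^sup>2) (J k X h)"
    using set_integrable_theta_error[of k X h] assms
    by (simp add: has_bochner_integral_iff set_integrable_def J_def set_lebesgue_integral_def theta_error_def)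
  then have R: "has_bochner_integral lborel ?R
      (2 * J k X h + 2 * (2 * X - X) + (M\<^sup>2 * (X - (X - h)) + M\<^sup>2 * (2 * X - (2 * X - h))))"
    using assms by (intro has_bochner_integral_add has_bochner_integral_mult_right ind) auto
  have "has_bochner_integral lborel (\<lambda>x. (window_sum k X h x)\<^sup>2)
      (\<Sum>m\<in>powers_range k X. \<Sum>n\<in>powers_range k X. coeff_SU m * coeff_SU n *
         max 0 (h - \<bar>real m powr k - real n powr k\<bar>))"
    unfolding window_sum_def using assms finite_powers_range[of k X]
    by (intro has_bochner_integral_window_sum_squared) auto
  then have int: "integrable lborel (\<lambda>x. (window_sum k X h x)\<^sup>2)"
    by (rule integrable.intros)
  have le: "(window_sum k X h x)\<^sup>2 \<le> ?R x" for x
  proof (cases "X \<le> x \<and> x + h \<le> 2 * X")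
    case True
    have "\<bar>window_sum k X h x - theta_error k h x\<bar> \<le> 1"
      using True assms by (intro window_sum_interior) auto
    then have "(window_sum k X h x - theta_error k h x)\<^sup>2 \<le> 1"
      by (simp add: abs_square_le_1)
    moreover have "(window_sum k X h x)\<^sup>2 \<le>
        2 * (theta_error k h x)\<^sup>2 + 2 * (window_sum k X h x - theta_error k h x)\<^sup>2"
      \<comment> \<open>The right side minus the left side is exactly this square.\<close>
      using zero_le_power2[of "window_sum k X h x - 2 * theta_error k h x"]
      by (simp add: power2_eq_square algebra_simps)
    ultimately have "(window_sum k X h x)\<^sup>2 \<le> 2 * (theta_error k h x)\<^sup>2 + 2" by linarith
    moreover have "indicator {X..2 * X} x = (1::real)" using True assms(3) by simp
    ultimately show ?thesis by (simp add: add_increasing2)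
  next
    case edge: False
    show ?thesis
    proof (cases "x \<in> {X - h..X} \<union> {2 * X - h..2 * X}")
      case True
      have "\<bar>window_sum k X h x\<bar> \<le> M"
        unfolding M_def using assms by (intro abs_window_sum_le) auto
      then have "(window_sum k X h x)\<^sup>2 \<le> M\<^sup>2"
        using power_mono[of "\<bar>window_sum k X h x\<bar>" M 2] by simp
      also have "\<dots> \<le> M\<^sup>2 * indicator {X - h..X} x + M\<^sup>2 * indicator {2 * X - h..2 * X} x"
        using True by (auto simp: indicator_def)
      also have "\<dots> \<le> ?R x" by simp
      finally show ?thesis .
    next
      \<comment> \<open>Such a window ends before X or starts after 2X, so it contains no frequency.
        The case distinction remains valid when h > X and the two edge intervals overlap.\<close>
      case False
      have "\<not> (n \<in> powers_range k X \<and> x < real n powr k \<and> real n powr k \<le> x + h)" for n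
        using edge False assms(3) by (auto simp: powers_range_def)
      then have "window_sum k X h x = 0"
        unfolding window_sum_def by (intro sum.neutral) blast
      then show ?thesis by simp
    qed
  qed
  have "(LBINT x. (window_sum k X h x)\<^sup>2) \<le> (LBINT x. ?R x)"
    using R by (intro Bochner_Integration.integral_mono int le) (auto simp: has_bochner_integral_iff)
  also have "\<dots> = 2 * J k X h + 2 * X + 2 * M\<^sup>2 * h"
    using has_bochner_integral_integral_eq[OF R] by simp
  finally show ?thesis .
qed

section \<open>Absorbing the edge term and collecting the estimates\<close>

text \<open>
  The window sums at both ends of the range contribute \<open>Y ln\<^sup>2 X\<close>; for \<open>k > 1\<close> neither of
  the first two error terms dominates it for all \<open>Y\<close>, but their sum does.
\<close>

lemma edge_term_le:
  fixes k X Y :: real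
  assumes "k > 0" "X \<ge> 3" "Y > 0"
  shows "(ln X)\<^sup>2 * Y \<le> (4 * k\<^sup>2)\<^sup>2 * (X powr (2 / k - 2) * (ln X)\<^sup>2 / Y) + Y\<^sup>2 * X"
proof (cases "(ln X)\<^sup>2 \<le> Y * X")
  case True
  then have "(ln X)\<^sup>2 * Y \<le> Y\<^sup>2 * X"
    using assms mult_right_mono[OF True, of Y] by (simp add: power2_eq_square mult_ac)
  moreover have "0 \<le> (4 * k\<^sup>2)\<^sup>2 * (X powr (2 / k - 2) * (ln X)\<^sup>2 / Y)" using assms by simp
  ultimately show ?thesis by linarith
next
  case False
  define q where "q = X powr (1 / k - 1)"
  have q2: "X powr (2 / k - 2) = q\<^sup>2"
    by (simp add: q_def power2_eq_square algebra_simps flip: powr_add)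
  \<comment> \<open>The exponent 1/(2k) is chosen so that squaring produces X^(1/k) = qX. Together
    with YX < (ln X)^2 this bounds Y by a multiple of q, so one factor Y can be traded for
    q^2/Y.\<close>
  have "ln X \<le> 2 * k * X powr (1 / (2 * k))"
    using ln_powr_bound[of X "1 / (2 * k)"] assms by (simp add: mult_ac)
  then have "(ln X)\<^sup>2 \<le> (2 * k * X powr (1 / (2 * k)))\<^sup>2"
    using assms by (intro power_mono) auto
  also have "\<dots> = 4 * k\<^sup>2 * X powr (1 / k)"
    using assms by (simp add: power_mult_distrib power2_eq_square flip: powr_add)
  also have "X powr (1 / k) = q * X"
    using assms by (simp add: q_def powr_diff)
  finally have "Y * X \<le> 4 * k\<^sup>2 * q * X" using False by simp
  then have "Y \<le> 4 * k\<^sup>2 * q" using assms by simp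
  then have "Y\<^sup>2 \<le> (4 * k\<^sup>2 * q)\<^sup>2" using assms by (intro power_mono) auto
  then have "Y \<le> (4 * k\<^sup>2 * q)\<^sup>2 / Y" using assms by (simp add: field_simps power2_eq_square)
  then have "(ln X)\<^sup>2 * Y \<le> (ln X)\<^sup>2 * ((4 * k\<^sup>2 * q)\<^sup>2 / Y)" by (intro mult_left_mono) auto
  also have "\<dots> = (4 * k\<^sup>2)\<^sup>2 * (X powr (2 / k - 2) * (ln X)\<^sup>2 / Y)"
    unfolding q2 by (simp add: power_mult_distrib mult_ac)
  finally show ?thesis using assms by (simp add: add_increasing2)
qed

theorem theorem2:
  fixes k :: real
  assumes "k > 0"
  shows "\<exists>C>0. \<exists>X\<^sub>0>0. \<forall>X\<ge>X\<^sub>0. \<forall>Y. 0 < Y \<and> Y \<le> 1 / 2 \<longrightarrow>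
    (LBINT \<alpha>:{-Y..Y}. (cmod (S k X \<alpha> - U k X \<alpha>))\<^sup>2)
      \<le> C * (X powr (2 / k - 2) * (ln X)\<^sup>2 / Y + Y\<^sup>2 * X + Y\<^sup>2 * J k X (1 / (2 * Y)))"
proof -
  define B L K where "B = 2 powr (1 / k) / k" and "L = 2 / k + 1" and "K = (4 * k\<^sup>2)\<^sup>2"
  \<comment> \<open>The bracket bounds each of the coefficients with which \<open>T1\<close>,
    \<open>T2\<close> and \<open>T3\<close> appear at the end.\<close>
  define C where "C = pi\<^sup>2 * (2 + 2 * L\<^sup>2 * (1 + K) + L\<^sup>2 * B\<^sup>2)"
  have K: "K \<ge> 0" by (simp add: K_def)
  have C: "C > 0" using K by (simp add: C_def add_pos_nonneg)
  have "(LBINT \<alpha>:{-Y..Y}. (cmod (S k X \<alpha> - U k X \<alpha>))\<^sup>2)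
      \<le> C * (X powr (2 / k - 2) * (ln X)\<^sup>2 / Y + Y\<^sup>2 * X + Y\<^sup>2 * J k X (1 / (2 * Y)))"
    if X: "X \<ge> 3" and Y: "0 < Y" "Y \<le> 1 / 2" for X Y
  proof -
    define h where "h = 1 / (2 * Y)"
    have h: "h > 0" using Y by (simp add: h_def)
    define q where "q = X powr (1 / k - 1)"
    have q2: "X powr (2 / k - 2) = q\<^sup>2"
      by (simp add: q_def power2_eq_square algebra_simps flip: powr_add)
    define T1 T2 T3 where "T1 = X powr (2 / k - 2) * (ln X)\<^sup>2 / Y" and "T2 = Y\<^sup>2 * X" and "T3 = Y\<^sup>2 * J k X h"
    have T: "T1 \<ge> 0" "T2 \<ge> 0" "T3 \<ge> 0"
      using X Y J_nonneg[of k X h] by (auto simp: T1_def T2_def T3_def)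
    define M where "M = (1 + B * q * h) * (L * ln X)"
    have "M\<^sup>2 = (1 + B * q * h)\<^sup>2 * (L * ln X)\<^sup>2" by (simp add: M_def power_mult_distrib)
    also have "\<dots> \<le> (2 + 2 * (B * q * h)\<^sup>2) * (L * ln X)\<^sup>2"
    proof (rule mult_right_mono)
      show "(1 + B * q * h)\<^sup>2 \<le> 2 + 2 * (B * q * h)\<^sup>2"
        using zero_le_power2[of "1 - B * q * h"] by (simp add: power2_eq_square algebra_simps)
    qed simp
    finally have "M\<^sup>2 * Y \<le> (2 + 2 * (B * q * h)\<^sup>2) * (L * ln X)\<^sup>2 * Y"
      using Y by (intro mult_right_mono) auto
    also have "\<dots> = 2 * L\<^sup>2 * ((ln X)\<^sup>2 * Y) + L\<^sup>2 * B\<^sup>2 / 2 * T1"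
      \<comment> \<open>Here h^2 Y = 1/(4Y), which turns the density part of
        \<open>M\<^sup>2\<close> into a multiple of the first error term.\<close>
      using Y unfolding T1_def q2 h_def by (simp add: field_simps power2_eq_square)
    also have "\<dots> \<le> 2 * L\<^sup>2 * (K * T1 + T2) + L\<^sup>2 * B\<^sup>2 / 2 * T1"
      using edge_term_le[OF assms X Y(1)]
      by (intro add_right_mono mult_left_mono) (auto simp: K_def T1_def T2_def)
    finally have M: "M\<^sup>2 * Y \<le> 2 * L\<^sup>2 * (K * T1 + T2) + L\<^sup>2 * B\<^sup>2 / 2 * T1" .
    have "(LBINT \<alpha>:{-Y..Y}. (cmod (S k X \<alpha> - U k X \<alpha>))\<^sup>2)
        \<le> pi\<^sup>2 * Y\<^sup>2 * (LBINT x. (window_sum k X h x)\<^sup>2)"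
      using Gallagher[OF finite_powers_range[OF assms] Y(1), of X coeff_SU "\<lambda>n. real n powr k"] X
      by (simp add: S_minus_U[OF assms] window_sum_def h_def)
    also have "\<dots> \<le> pi\<^sup>2 * Y\<^sup>2 * (2 * J k X h + 2 * X + 2 * M\<^sup>2 * h)"
      using window_sum_energy[OF assms X h] by (intro mult_left_mono) (auto simp: M_def B_def L_def q_def)
    \<comment> \<open>The edge contribution becomes \<open>M\<^sup>2 * Y\<close> because 2 h Y^2 =
      Y.\<close>
    also have "\<dots> = pi\<^sup>2 * (2 * T3 + 2 * T2 + M\<^sup>2 * Y)"
      using Y by (simp add: T2_def T3_def h_def field_simps power2_eq_square)
    also have "\<dots> \<le> pi\<^sup>2 * (2 * T3 + 2 * T2 + (2 * L\<^sup>2 * (K * T1 + T2) + L\<^sup>2 * B\<^sup>2 / 2 * T1))"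
      using M by (intro mult_left_mono) auto
    also have "\<dots> \<le> pi\<^sup>2 * ((2 + 2 * L\<^sup>2 * (1 + K) + L\<^sup>2 * B\<^sup>2) * (T1 + T2 + T3))"
    proof (intro mult_left_mono)
      \<comment> \<open>This is the difference of the two sides of the desired inequality.\<close>
      have "0 \<le> 2 * T1 + 2 * L\<^sup>2 * (T1 + T3 + K * T2 + K * T3) + L\<^sup>2 * B\<^sup>2 * (T1 / 2 + T2 + T3)"
        using T K by (intro add_nonneg_nonneg mult_nonneg_nonneg) auto
      then show "2 * T3 + 2 * T2 + (2 * L\<^sup>2 * (K * T1 + T2) + L\<^sup>2 * B\<^sup>2 / 2 * T1)
          \<le> (2 + 2 * L\<^sup>2 * (1 + K) + L\<^sup>2 * B\<^sup>2) * (T1 + T2 + T3)"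
        by (simp add: algebra_simps)
    qed auto
    finally show ?thesis by (simp add: C_def T1_def T2_def T3_def h_def mult.assoc)
  qed
  then show ?thesis using C by (intro exI[of _ C] conjI exI[of _ 3]) auto
qed

end
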